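(* Let $(F^*,E^*,I^* )$ and $(\overline F^*,\overline E^*,\overline I^* )$ be two compatible spark complexes, with groups of spark classes $\widehat{\mathbf H}^k$ and $\widehat{\overline{\mathbf H}}{}^k$ respectively. Then there is a natural isomorphism $$\widehat{\mathbf H}^k\cong\widehat{\overline{\mathbf H}}{}^k,\qquad k=-1,0,1,\dots,$$ natural meaning: determined by the maps that the inclusions into a common spark complex, containing both as subspark complexes, induce on groups of spark classes.
   Context: A spark complex consists of a differential complex $(F^*,d)$ of abelian groups, graded in degrees $\ge 0$ (so $F^{-1}=0$), together with two subcomplexes $E^*\subset F^*$ and $I^*\subset F^*$ such that (A) the inclusion induces $H^k(E^* )\cong H^k(F^* )$ for $k=0,1,\dots$, and (B) $E^k\cap I^k=\{0\}$ for $k=1,2,\dots$. For $k\ge 0$ a homological spark of degree $k$ is an element $a\in F^k$ with $da=\phi-r$ for some $\phi\in E^{k+1}$ and $r\in I^{k+1}$. Two sparks of degree $k$ are equivalent if their difference is of the form $db+s$ with $b\in F^{k-1}$ and $s\in I^k$. $\widehat{\mathbf H}^k$ is the group of equivalence classes of sparks of degree $k$. For $k=-1$ one sets $\widehat{\mathbf H}^{-1}=H^0(I^* )$. A spark complex $(F^*,E^*,I^* )$ is a subspark complex of a spark complex $(\overline F^*,\overline E^*,\overline I^* )$ if $F^*\subset\overline F^*$ is a differential subcomplex, $E^*=\overline E^*$, and $I^*\subset\overline I^*$ with the inclusion inducing isomorphisms $H^*(I^* )\cong H^*(\overline I^* )$. Two spark complexes are compatible if they can both be embedded as subspark complexes of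 one and the same spark complex. *)

theory Defs
  imports "HOL-Algebra.Algebra"
begin

text \<open>
  Abelian groups are commutative groups of \<open>HOL-Algebra\<close>, hence written multiplicatively:
  \<open>\<phi> - r\<close> becomes \<open>\<phi> \<otimes> inv r\<close> and \<open>0\<close> becomes \<open>\<one>\<close>.
\<close>

section \<open>Maps induced on quotient groups\<close>

text \<open>
  If \<open>h\<close> is a homomorphism into \<open>G\<close> that maps the subgroup divided out in its domain into \<open>N\<close>,
  the image of a coset is contained in one coset of \<open>N\<close>, which is \<open>N <#> h ` A\<close>;
  see \<open>quot_map_coset\<close>.
\<close>

definition quot_map :: "('b, 'n) monoid_scheme \<Rightarrow> 'b set \<Rightarrow> ('a \<Rightarrow> 'b) \<Rightarrow> 'a set \<Rightarrow> 'b set" where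
  "quot_map G N h A = N <#>\<^bsub>G\<^esub> (h ` A)"

lemma quot_map_coset:
  assumes "group G" "group H" "h \<in> hom G H" "subgroup M G" "subgroup N H" "h ` M \<subseteq> N"
    and a: "a \<in> carrier G"
  shows "quot_map H N h (M #>\<^bsub>G\<^esub> a) = N #>\<^bsub>H\<^esub> h a"
proof -
  interpret G: group G by fact
  interpret H: group H by fact
  interpret M: subgroup M G by fact
  interpret N: subgroup N H by fact
  have ha: "h a \<in> carrier H" using assms(3) a by (auto simp: hom_def)
  have hM: "h (m \<otimes>\<^bsub>G\<^esub> a) = h m \<otimes>\<^bsub>H\<^esub> h a" if "m \<in> M" for m
    using assms(3) a that by (auto intro: hom_mult)
  have h1: "h \<one>\<^bsub>G\<^esub> = \<one>\<^bsub>H\<^esub>"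
    using assms(1-3) by (simp add: hom_one)
  show ?thesis
  proof (intro equalityI subsetI)
    fix x assume "x \<in> quot_map H N h (M #>\<^bsub>G\<^esub> a)"
    then obtain n m where nm: "n \<in> N" "m \<in> M" "x = n \<otimes>\<^bsub>H\<^esub> (h m \<otimes>\<^bsub>H\<^esub> h a)"
      by (auto simp: quot_map_def set_mult_def r_coset_def hM)
    moreover have "h m \<in> N" using assms(6) nm by auto
    ultimately have "x = (n \<otimes>\<^bsub>H\<^esub> h m) \<otimes>\<^bsub>H\<^esub> h a" "n \<otimes>\<^bsub>H\<^esub> h m \<in> N"
      using ha by (auto simp: H.m_assoc)
    then show "x \<in> N #>\<^bsub>H\<^esub> h a" by (auto simp: r_coset_def)
  next
    fix x assume "x \<in> N #>\<^bsub>H\<^esub> h a"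
    then obtain n where "n \<in> N" "x = n \<otimes>\<^bsub>H\<^esub> h a" by (auto simp: r_coset_def)
    moreover have "a \<in> M #>\<^bsub>G\<^esub> a" by (rule G.rcos_self) (fact a, fact assms(4))
    ultimately show "x \<in> quot_map H N h (M #>\<^bsub>G\<^esub> a)"
      by (auto simp: quot_map_def set_mult_def)
  qed
qed


section \<open>Cochain complexes and their cohomology\<close>

definition cochain_complex :: "(nat \<Rightarrow> 'a monoid) \<Rightarrow> (nat \<Rightarrow> 'a \<Rightarrow> 'a) \<Rightarrow> bool" where
  "cochain_complex F d \<longleftrightarrow>
     (\<forall>k. comm_group (F k)) \<and>
     (\<forall>k. d k \<in> hom (F k) (F (Suc k))) \<and>
     (\<forall>k. \<forall>x \<in> carrier (F k). d (Suc k) (d k x) = \<one>\<^bsub>F (Suc (Suc k))\<^esub>)"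

definition subcomplex :: "(nat \<Rightarrow> 'a monoid) \<Rightarrow> (nat \<Rightarrow> 'a \<Rightarrow> 'a) \<Rightarrow> (nat \<Rightarrow> 'a set) \<Rightarrow> bool" where
  "subcomplex F d C \<longleftrightarrow> (\<forall>k. subgroup (C k) (F k)) \<and> (\<forall>k. d k ` C k \<subseteq> C (Suc k))"

definition restrict_complex :: "(nat \<Rightarrow> 'a monoid) \<Rightarrow> (nat \<Rightarrow> 'a set) \<Rightarrow> nat \<Rightarrow> 'a monoid" where
  "restrict_complex F C k = (F k)\<lparr>carrier := C k\<rparr>"

definition cocycles :: "(nat \<Rightarrow> 'a monoid) \<Rightarrow> (nat \<Rightarrow> 'a \<Rightarrow> 'a) \<Rightarrow> nat \<Rightarrow> 'a set" where
  "cocycles F d k = kernel (F k) (F (Suc k)) (d k)"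

text \<open>In degree \<open>0\<close> the coboundaries are trivial, because \<open>F\<^sup>-\<^sup>1 = 0\<close>.\<close>

definition coboundaries :: "(nat \<Rightarrow> 'a monoid) \<Rightarrow> (nat \<Rightarrow> 'a \<Rightarrow> 'a) \<Rightarrow> nat \<Rightarrow> 'a set" where
  "coboundaries F d k = (case k of 0 \<Rightarrow> {\<one>\<^bsub>F 0\<^esub>} | Suc j \<Rightarrow> d j ` carrier (F j))"

definition cohomology :: "(nat \<Rightarrow> 'a monoid) \<Rightarrow> (nat \<Rightarrow> 'a \<Rightarrow> 'a) \<Rightarrow> nat \<Rightarrow> 'a set monoid" where
  "cohomology F d k = (F k)\<lparr>carrier := cocycles F d k\<rparr> Mod coboundaries F d k"

text \<open>\<open>F\<close> and \<open>d\<close> are the target complex of the cochain map \<open>f\<close>.\<close>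

definition cohomology_map ::
  "(nat \<Rightarrow> 'b monoid) \<Rightarrow> (nat \<Rightarrow> 'b \<Rightarrow> 'b) \<Rightarrow> (nat \<Rightarrow> 'a \<Rightarrow> 'b) \<Rightarrow> nat \<Rightarrow> 'a set \<Rightarrow> 'b set" where
  "cohomology_map F d f k = quot_map (F k) (coboundaries F d k) (f k)"


section \<open>Spark complexes\<close>

record 'a spark_cx =
  cxF :: "nat \<Rightarrow> 'a monoid"
  cxd :: "nat \<Rightarrow> 'a \<Rightarrow> 'a"
  cxE :: "nat \<Rightarrow> 'a set"
  cxI :: "nat \<Rightarrow> 'a set"

abbreviation complexE :: "'a spark_cx \<Rightarrow> nat \<Rightarrow> 'a monoid" where
  "complexE S \<equiv> restrict_complex (cxF S) (cxE S)"

abbreviation complexI :: "'a spark_cx \<Rightarrow> nat \<Rightarrow> 'a monoid" where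
  "complexI S \<equiv> restrict_complex (cxF S) (cxI S)"

definition spark_complex :: "'a spark_cx \<Rightarrow> bool" where
  "spark_complex S \<longleftrightarrow>
     cochain_complex (cxF S) (cxd S) \<and>
     subcomplex (cxF S) (cxd S) (cxE S) \<and>
     subcomplex (cxF S) (cxd S) (cxI S) \<and>
     (\<forall>k. cohomology_map (cxF S) (cxd S) (\<lambda>_. id) k
            \<in> iso (cohomology (complexE S) (cxd S) k) (cohomology (cxF S) (cxd S) k)) \<and>
     (\<forall>k\<ge>1. cxE S k \<inter> cxI S k = {\<one>\<^bsub>cxF S k\<^esub>})"


section \<open>Groups of spark classes\<close>

definition sparks :: "'a spark_cx \<Rightarrow> nat \<Rightarrow> 'a set" where
  "sparks S k = {a \<in> carrier (cxF S k).
     \<exists>\<phi> \<in> cxE S (Suc k). \<exists>r \<in> cxI S (Suc k).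
       cxd S k a = \<phi> \<otimes>\<^bsub>cxF S (Suc k)\<^esub> inv\<^bsub>cxF S (Suc k)\<^esub> r}"

text \<open>
  The elements \<open>db + s\<close>. Two sparks are equivalent iff their difference lies here, so the
  equivalence classes are the cosets of this subgroup.
\<close>

definition trivial_sparks :: "'a spark_cx \<Rightarrow> nat \<Rightarrow> 'a set" where
  "trivial_sparks S k =
     {c \<otimes>\<^bsub>cxF S k\<^esub> s | c s. c \<in> coboundaries (cxF S) (cxd S) k \<and> s \<in> cxI S k}"

text \<open>The degree is an integer \<open>k \<ge> -1\<close>; the value for \<open>k < -1\<close> is irrelevant.\<close>

definition spark_class_group :: "'a spark_cx \<Rightarrow> int \<Rightarrow> 'a set monoid" where
  "spark_class_group S k =
     (if k = -1 then cohomology (complexI S) (cxd S) 0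
      else (cxF S (nat k))\<lparr>carrier := sparks S (nat k)\<rparr> Mod trivial_sparks S (nat k))"

text \<open>The map induced by \<open>f\<close> on classes, with target the spark complex \<open>T\<close>.\<close>

definition spark_class_map ::
  "'b spark_cx \<Rightarrow> (nat \<Rightarrow> 'a \<Rightarrow> 'b) \<Rightarrow> int \<Rightarrow> 'a set \<Rightarrow> 'b set" where
  "spark_class_map T f k =
     (if k = -1 then cohomology_map (complexI T) (cxd T) f 0
      else quot_map (cxF T (nat k)) (trivial_sparks T (nat k)) (f (nat k)))"


section \<open>Subspark complexes and compatibility\<close>

definition subspark_complex :: "'a spark_cx \<Rightarrow> 'a spark_cx \<Rightarrow> bool" where
  "subspark_complex S U \<longleftrightarrow>
     spark_complex S \<and> spark_complex U \<and>
     subcomplex (cxF U) (cxd U) (\<lambda>k. carrier (cxF S k)) \<and>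
     (\<forall>k. \<forall>x \<in> carrier (cxF S k). \<forall>y \<in> carrier (cxF S k). x \<otimes>\<^bsub>cxF S k\<^esub> y = x \<otimes>\<^bsub>cxF U k\<^esub> y) \<and>
     (\<forall>k. \<forall>x \<in> carrier (cxF S k). cxd S k x = cxd U k x) \<and>
     (\<forall>k. cxE S k = cxE U k) \<and>
     (\<forall>k. cxI S k \<subseteq> cxI U k) \<and>
     (\<forall>k. cohomology_map (complexI U) (cxd U) (\<lambda>_. id) k
            \<in> iso (cohomology (complexI S) (cxd S) k) (cohomology (complexI U) (cxd U) k))"

definition image_spark_cx ::
  "(nat \<Rightarrow> 'a \<Rightarrow> 'b) \<Rightarrow> 'a spark_cx \<Rightarrow> 'b spark_cx \<Rightarrow> 'b spark_cx" where
  "image_spark_cx f S U =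
     \<lparr>cxF = restrict_complex (cxF U) (\<lambda>k. f k ` carrier (cxF S k)),
      cxd = cxd U,
      cxE = (\<lambda>k. f k ` cxE S k),
      cxI = (\<lambda>k. f k ` cxI S k)\<rparr>"

definition subspark_embedding ::
  "'a spark_cx \<Rightarrow> 'b spark_cx \<Rightarrow> (nat \<Rightarrow> 'a \<Rightarrow> 'b) \<Rightarrow> bool" where
  "subspark_embedding S U f \<longleftrightarrow>
     spark_complex S \<and>
     (\<forall>k. f k \<in> mon (cxF S k) (cxF U k)) \<and>
     (\<forall>k. \<forall>x \<in> carrier (cxF S k). f (Suc k) (cxd S k x) = cxd U k (f k x)) \<and>
     subspark_complex (image_spark_cx f S U) U"

text \<open>
  Compatibility of \<open>S\<close> and \<open>T\<close> means that some \<open>U\<close>, \<open>i\<close>, \<open>j\<close> as below exist. They are kept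
  explicit because the carrier type of \<open>U\<close> is arbitrary and because they determine the
  isomorphism of spark classes.
\<close>

definition compatible_via ::
  "'c spark_cx \<Rightarrow> (nat \<Rightarrow> 'a \<Rightarrow> 'c) \<Rightarrow> (nat \<Rightarrow> 'b \<Rightarrow> 'c) \<Rightarrow> 'a spark_cx \<Rightarrow> 'b spark_cx \<Rightarrow> bool" where
  "compatible_via U i j S T \<longleftrightarrow> subspark_embedding S U i \<and> subspark_embedding T U j"

end

theory Submission
  imports Defs
begin

text \<open>
  A subspark embedding \<open>f\<close> of \<open>S\<close> into \<open>U\<close> induces isomorphisms on spark classes. For compatible
  \<open>S\<close> and \<open>T\<close>, both embedded in \<open>U\<close>, the asserted isomorphism is then the composite of one such
  isomorphism with the inverse of the other.

  Two quasi-isomorphisms are available (\<open>subspark_embeddingD\<close>): \<open>I\<^sub>S \<rightarrow> I\<^sub>U\<close> by assumption, and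
  \<open>F\<^sub>S \<rightarrow> F\<^sub>U\<close> because \<open>E\<^sub>S \<rightarrow> F\<^sub>S\<close> is one and the composite \<open>E\<^sub>S \<cong> E\<^sub>U \<rightarrow> F\<^sub>U\<close> is one. In degree
  \<open>-1\<close> the first of them is the claim. In degree \<open>k \<ge> 0\<close>, additively, with \<open>f\<close> written as an
  inclusion and the sign of the \<open>I\<close>-part of \<open>da\<close> absorbed into \<open>r\<close>:

  Surjectivity (\<open>subspark_embedding_sparks_onto\<close>). Let \<open>da = \<phi> + r\<close> be a spark of \<open>U\<close>. As
  \<open>d\<phi> = - dr\<close> lies in \<open>E \<inter> I = 0\<close>, \<open>r\<close> is a cocycle of \<open>I\<^sub>U\<close>, so \<open>r = ds + r'\<close> with \<open>s\<close> in \<open>I\<^sub>U\<close> and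
  a cocycle \<open>r'\<close> of \<open>I\<^sub>S\<close>. The element \<open>\<phi> + r' = d(a - s)\<close> of \<open>F\<^sub>S\<close> is a coboundary in \<open>F\<^sub>U\<close>, hence
  equal to \<open>dv\<close> with \<open>v\<close> in \<open>F\<^sub>S\<close>. Now \<open>a - s - v\<close> is a cocycle, so it is \<open>w + c\<close> with a coboundary
  \<open>w\<close> and a cocycle \<open>c\<close> of \<open>F\<^sub>S\<close>. Thus \<open>a\<close> is equivalent to the spark \<open>c + v\<close> of \<open>S\<close>.

  Injectivity (\<open>subspark_embedding_trivial_sparksD\<close>). Let \<open>da = \<phi> + r\<close> be a spark of \<open>S\<close> that
  equals \<open>b + s\<close> with a coboundary \<open>b\<close> of \<open>F\<^sub>U\<close> and \<open>s\<close> in \<open>I\<^sub>U\<close>. Then \<open>\<phi> = ds - r\<close> lies in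
  \<open>E \<inter> I = 0\<close>, so \<open>r = ds\<close> and therefore \<open>r = ds'\<close> with \<open>s'\<close> in \<open>I\<^sub>S\<close>. The cocycle \<open>s - s'\<close> of
  \<open>I\<^sub>U\<close> is \<open>z + t\<close> with a coboundary \<open>z\<close> and a cocycle \<open>t\<close> of \<open>I\<^sub>S\<close>. Hence \<open>a - (t + s') = b + z\<close> is
  an element of \<open>F\<^sub>S\<close> that is a coboundary in \<open>F\<^sub>U\<close>, so it is one in \<open>F\<^sub>S\<close>, and \<open>a\<close> is trivial in \<open>S\<close>.
\<close>

section \<open>Isomorphisms of quotients, elementwise\<close>

text \<open>The induced map depends only on the multiplication, so it may be computed in an ambient group.\<close>

lemma quot_map_restrict [simp]: "quot_map (G\<lparr>carrier := C\<rparr>) N h = quot_map G N h"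
  by (rule ext) (simp add: quot_map_def set_mult_def)

lemma comm_group_restrict:
  assumes "comm_group G" "subgroup H G" shows "comm_group (G\<lparr>carrier := H\<rparr>)"
proof -
  interpret comm_group G by fact
  interpret subgroup H G by fact
  interpret H: group "G\<lparr>carrier := H\<rparr>" by (rule subgroup_is_group) (rule group_axioms)
  show ?thesis by (rule H.group_comm_groupI) (simp add: m_comm)
qed

text \<open>
  This criterion serves twice: for cohomology groups, to read off representatives from an
  isomorphism, and for spark classes, to produce one.
\<close>

lemma quot_map_iso_iff:
  assumes G: "comm_group G" and H: "comm_group H" and h: "h \<in> hom G H"
    and M: "subgroup M G" and N: "subgroup N H" and MN: "h ` M \<subseteq> N"
  shows "quot_map H N h \<in> iso (G Mod M) (H Mod N) \<longleftrightarrow>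
    (\<forall>a\<in>carrier G. h a \<in> N \<longrightarrow> a \<in> M) \<and>
    (\<forall>b\<in>carrier H. \<exists>a\<in>carrier G. \<exists>n\<in>N. b = n \<otimes>\<^bsub>H\<^esub> h a)"
    (is "?iso \<longleftrightarrow> ?inj \<and> ?surj")
proof -
  interpret G: comm_group G by fact
  interpret H: comm_group H by fact
  interpret h: group_hom G H h by unfold_locales (fact h)
  interpret M: normal M G by (rule G.subgroup_imp_normal) fact
  interpret N: normal N H by (rule H.subgroup_imp_normal) fact
  interpret Q: group "H Mod N" by (rule N.factorgroup_is_group)
  interpret P: group "G Mod M" by (rule M.factorgroup_is_group)
  have q: "quot_map H N h (M #>\<^bsub>G\<^esub> a) = N #>\<^bsub>H\<^esub> h a" if "a \<in> carrier G" for a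
    using quot_map_coset[OF G.is_group H.is_group h M N MN that] .
  have qhom: "quot_map H N h \<in> hom (G Mod M) (H Mod N)"
  proof (rule homI)
    fix A assume "A \<in> carrier (G Mod M)"
    then show "quot_map H N h A \<in> carrier (H Mod N)"
      by (auto simp: carrier_FactGroup q)
  next
    fix A B assume "A \<in> carrier (G Mod M)" "B \<in> carrier (G Mod M)"
    then obtain a b where "a \<in> carrier G" "A = M #>\<^bsub>G\<^esub> a" "b \<in> carrier G" "B = M #>\<^bsub>G\<^esub> b"
      by (auto simp: carrier_FactGroup)
    then show "quot_map H N h (A \<otimes>\<^bsub>G Mod M\<^esub> B) =
        quot_map H N h A \<otimes>\<^bsub>H Mod N\<^esub> quot_map H N h B"
      by (simp add: M.rcos_sum N.rcos_sum q)
  qed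
  interpret q: group_hom "G Mod M" "H Mod N" "quot_map H N h"
    by unfold_locales (fact qhom)
  have cosN: "N #>\<^bsub>H\<^esub> b = N \<longleftrightarrow> b \<in> N" if "b \<in> carrier H" for b
    using H.coset_join1[OF _ that N] H.coset_join2[OF that N] by blast
  have cosM: "M #>\<^bsub>G\<^esub> a = M \<longleftrightarrow> a \<in> M" if "a \<in> carrier G" for a
    using G.coset_join1[OF _ that M] G.coset_join2[OF that M] by blast
  have "inj_on (quot_map H N h) (carrier (G Mod M)) \<longleftrightarrow>
      (\<forall>a\<in>carrier G. N #>\<^bsub>H\<^esub> h a = N \<longrightarrow> M #>\<^bsub>G\<^esub> a = M)"
    unfolding q.inj_on_one_iff Ball_def[symmetric] by (simp add: carrier_FactGroup q)
  then have "inj_on (quot_map H N h) (carrier (G Mod M)) \<longleftrightarrow> ?inj"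
    by (simp add: cosN cosM)
  moreover have "quot_map H N h ` carrier (G Mod M) = carrier (H Mod N) \<longleftrightarrow> ?surj"
  proof
    assume L: "quot_map H N h ` carrier (G Mod M) = carrier (H Mod N)"
    show ?surj
    proof
      fix b assume b: "b \<in> carrier H"
      then have "N #>\<^bsub>H\<^esub> b \<in> quot_map H N h ` carrier (G Mod M)"
        unfolding L by (auto simp: carrier_FactGroup)
      then obtain a where a: "a \<in> carrier G" "N #>\<^bsub>H\<^esub> b = N #>\<^bsub>H\<^esub> h a"
        by (auto simp: carrier_FactGroup q)
      then have "b \<in> N #>\<^bsub>H\<^esub> h a" using H.rcos_self[OF b N] by simp
      then show "\<exists>a\<in>carrier G. \<exists>n\<in>N. b = n \<otimes>\<^bsub>H\<^esub> h a"
        using a by (auto simp: r_coset_def)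
    qed
  next
    assume R: ?surj
    show "quot_map H N h ` carrier (G Mod M) = carrier (H Mod N)"
    proof (intro equalityI subsetI)
      fix B assume "B \<in> carrier (H Mod N)"
      then obtain b where b: "b \<in> carrier H" "B = N #>\<^bsub>H\<^esub> b" by (auto simp: carrier_FactGroup)
      then obtain a n where a: "a \<in> carrier G" "n \<in> N" "b = n \<otimes>\<^bsub>H\<^esub> h a" using R by blast
      then have "b \<in> N #>\<^bsub>H\<^esub> h a" by (auto simp: r_coset_def)
      then have "B = quot_map H N h (M #>\<^bsub>G\<^esub> a)"
        using a b N by (simp add: q H.repr_independence[symmetric])
      then show "B \<in> quot_map H N h ` carrier (G Mod M)"
        using a by (auto simp: carrier_FactGroup)
    qed auto
  qed
  moreover have "?iso \<longleftrightarrow> inj_on (quot_map H N h) (carrier (G Mod M)) \<and>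
      quot_map H N h ` carrier (G Mod M) = carrier (H Mod N)"
    using qhom unfolding iso_iff by blast
  ultimately show ?thesis by argo
qed


section \<open>Quasi-isomorphisms, elementwise\<close>

text \<open>
  Cochain maps; that source and target are complexes is not part of the definition.
\<close>

definition cochain_map ::
  "(nat \<Rightarrow> 'a monoid) \<Rightarrow> (nat \<Rightarrow> 'a \<Rightarrow> 'a) \<Rightarrow> (nat \<Rightarrow> 'b monoid) \<Rightarrow> (nat \<Rightarrow> 'b \<Rightarrow> 'b) \<Rightarrow>
    (nat \<Rightarrow> 'a \<Rightarrow> 'b) \<Rightarrow> bool" where
  "cochain_map F d G e f \<longleftrightarrow>
     (\<forall>k. f k \<in> hom (F k) (G k)) \<and> (\<forall>k. \<forall>x\<in>carrier (F k). f (Suc k) (d k x) = e k (f k x))"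

text \<open>
  Quasi-isomorphisms, with injectivity and surjectivity in cohomology spelled out on
  representatives. For cochain maps this is the same as inducing isomorphisms in cohomology,
  see \<open>cohomology_map_iso_iff\<close>.
\<close>

definition quasi_iso ::
  "(nat \<Rightarrow> 'a monoid) \<Rightarrow> (nat \<Rightarrow> 'a \<Rightarrow> 'a) \<Rightarrow> (nat \<Rightarrow> 'b monoid) \<Rightarrow> (nat \<Rightarrow> 'b \<Rightarrow> 'b) \<Rightarrow>
    (nat \<Rightarrow> 'a \<Rightarrow> 'b) \<Rightarrow> bool" where
  "quasi_iso F d G e f \<longleftrightarrow> (\<forall>k.
     (\<forall>x\<in>cocycles F d k. f k x \<in> coboundaries G e k \<longrightarrow> x \<in> coboundaries F d k) \<and>
     (\<forall>y\<in>cocycles G e k. \<exists>x\<in>cocycles F d k. \<exists>z\<in>coboundaries G e k. y = z \<otimes>\<^bsub>G k\<^esub> f k x))"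

lemma quasi_isoD_inj:
  "quasi_iso F d G e f \<Longrightarrow> x \<in> cocycles F d k \<Longrightarrow> f k x \<in> coboundaries G e k
    \<Longrightarrow> x \<in> coboundaries F d k"
  by (auto simp: quasi_iso_def)

lemma quasi_isoD_surj:
  assumes "quasi_iso F d G e f" "y \<in> cocycles G e k"
  obtains x z where "x \<in> cocycles F d k" "z \<in> coboundaries G e k" "y = z \<otimes>\<^bsub>G k\<^esub> f k x"
  using assms unfolding quasi_iso_def by blast

lemma cochain_complexD:
  assumes "cochain_complex F d"
  shows "comm_group (F k)" "d k \<in> hom (F k) (F (Suc k))"
    "x \<in> carrier (F k) \<Longrightarrow> d (Suc k) (d k x) = \<one>\<^bsub>F (Suc (Suc k))\<^esub>"
  using assms by (auto simp: cochain_complex_def)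

lemma cochain_complex_group_hom:
  "cochain_complex F d \<Longrightarrow> group_hom (F k) (F (Suc k)) (d k)"
  by (auto simp: cochain_complex_def group_hom_def group_hom_axioms_def comm_group_def)

lemma subgroup_cocycles: "cochain_complex F d \<Longrightarrow> subgroup (cocycles F d k) (F k)"
  unfolding cocycles_def by (rule group_hom.subgroup_kernel[OF cochain_complex_group_hom])

lemma subgroup_coboundaries:
  assumes "cochain_complex F d" shows "subgroup (coboundaries F d k) (F k)"
proof (cases k)
  case 0
  then show ?thesis
    using cochain_complexD(1)[OF assms, of 0]
    by (simp add: coboundaries_def group.triv_subgroup comm_group_def)
next
  case (Suc j)
  then show ?thesis
    using group_hom.img_is_subgroup[OF cochain_complex_group_hom[OF assms]]
    by (simp add: coboundaries_def)
qed

lemma coboundaries_subset_cocycles: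
  assumes "cochain_complex F d" shows "coboundaries F d k \<subseteq> cocycles F d k"
proof (cases k)
  case 0
  then show ?thesis
    using subgroup.one_closed[OF subgroup_cocycles[OF assms, of 0]] by (simp add: coboundaries_def)
next
  case (Suc j)
  then show ?thesis
    using cochain_complexD[OF assms] by (auto simp: coboundaries_def cocycles_def kernel_def hom_def)
qed

lemma cochain_map_one:
  assumes "cochain_complex F d" "cochain_complex G e" "cochain_map F d G e f"
  shows "f k \<one>\<^bsub>F k\<^esub> = \<one>\<^bsub>G k\<^esub>"
  using assms by (auto simp: cochain_complex_def cochain_map_def comm_group_def intro!: hom_one)

lemma cochain_map_cocycles:
  assumes F: "cochain_complex F d" and G: "cochain_complex G e" and f: "cochain_map F d G e f"
    and x: "x \<in> cocycles F d k"
  shows "f k x \<in> cocycles G e k"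
proof -
  have hom: "f k \<in> hom (F k) (G k)" and comm: "f (Suc k) (d k x) = e k (f k x)"
    using f x unfolding cochain_map_def cocycles_def kernel_def by blast+
  moreover have "f (Suc k) (d k x) = \<one>\<^bsub>G (Suc k)\<^esub>"
    using x cochain_map_one[OF F G f] by (simp add: cocycles_def kernel_def)
  ultimately show ?thesis using x by (auto simp: cocycles_def kernel_def hom_def)
qed

lemma cochain_map_coboundaries:
  assumes F: "cochain_complex F d" and G: "cochain_complex G e" and f: "cochain_map F d G e f"
    and x: "x \<in> coboundaries F d k"
  shows "f k x \<in> coboundaries G e k"
proof (cases k)
  case 0
  then show ?thesis using x cochain_map_one[OF F G f] by (simp add: coboundaries_def)
next
  case (Suc j)
  then obtain w where w: "w \<in> carrier (F j)" "x = d j w" using x by (auto simp: coboundaries_def)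
  have "f j w \<in> carrier (G j)" "f k x = e j (f j w)"
    using f w Suc by (auto simp: cochain_map_def hom_def)
  then show ?thesis using Suc by (simp add: coboundaries_def)
qed

lemma cohomology_map_iso_iff:
  assumes F: "cochain_complex F d" and G: "cochain_complex G e" and f: "cochain_map F d G e f"
  shows "(\<forall>k. cohomology_map G e f k \<in> iso (cohomology F d k) (cohomology G e k))
    \<longleftrightarrow> quasi_iso F d G e f"
proof -
  have "cohomology_map G e f k \<in> iso (cohomology F d k) (cohomology G e k) \<longleftrightarrow>
     (\<forall>x\<in>cocycles F d k. f k x \<in> coboundaries G e k \<longrightarrow> x \<in> coboundaries F d k) \<and>
     (\<forall>y\<in>cocycles G e k. \<exists>x\<in>cocycles F d k. \<exists>z\<in>coboundaries G e k. y = z \<otimes>\<^bsub>G k\<^esub> f k x)" for k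
  proof -
    interpret F: comm_group "F k" by (rule cochain_complexD(1)[OF F])
    interpret G: comm_group "G k" by (rule cochain_complexD(1)[OF G])
    let ?F = "F k\<lparr>carrier := cocycles F d k\<rparr>" and ?G = "G k\<lparr>carrier := cocycles G e k\<rparr>"
    have "f k \<in> hom (F k) (G k)" using f by (auto simp: cochain_map_def)
    then have "f k \<in> hom ?F ?G"
      using cochain_map_cocycles[OF F G f] subgroup.mem_carrier[OF subgroup_cocycles[OF F, of k]]
      by (simp add: hom_def)
    then have "quot_map ?G (coboundaries G e k) (f k) \<in>
        iso (?F Mod coboundaries F d k) (?G Mod coboundaries G e k) \<longleftrightarrow>
       (\<forall>x\<in>carrier ?F. f k x \<in> coboundaries G e k \<longrightarrow> x \<in> coboundaries F d k) \<and>
       (\<forall>y\<in>carrier ?G. \<exists>x\<in>carrier ?F. \<exists>z\<in>coboundaries G e k. y = z \<otimes>\<^bsub>?G\<^esub> f k x)"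
      using cochain_map_coboundaries[OF F G f]
      by (intro quot_map_iso_iff comm_group_restrict subgroup_cocycles
          F.subgroup_incl G.subgroup_incl subgroup_coboundaries coboundaries_subset_cocycles
          F G F.comm_group_axioms G.comm_group_axioms) auto
    then show ?thesis by (simp add: cohomology_map_def cohomology_def)
  qed
  then show ?thesis by (simp add: quasi_iso_def)
qed

lemma restrict_complex_simps [simp]:
  "carrier (restrict_complex F C k) = C k"
  "monoid.mult (restrict_complex F C k) = monoid.mult (F k)"
  "one (restrict_complex F C k) = one (F k)"
  "restrict_complex (restrict_complex F C) D = restrict_complex F D"
  by (simp_all add: restrict_complex_def fun_eq_iff)

lemma subcomplexD:
  assumes "subcomplex F d C"
  shows "subgroup (C k) (F k)" "x \<in> C k \<Longrightarrow> d k x \<in> C (Suc k)"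
    "x \<in> C k \<Longrightarrow> x \<in> carrier (F k)"
proof -
  show sub: "subgroup (C k) (F k)" using assms by (simp add: subcomplex_def)
  show "x \<in> C k \<Longrightarrow> d k x \<in> C (Suc k)" using assms by (auto simp: subcomplex_def)
  show "x \<in> C k \<Longrightarrow> x \<in> carrier (F k)" by (rule subgroup.mem_carrier[OF sub])
qed

lemma cochain_complex_restrict:
  assumes F: "cochain_complex F d" and C: "subcomplex F d C"
  shows "cochain_complex (restrict_complex F C) d"
proof -
  have "comm_group (restrict_complex F C k)" for k
    unfolding restrict_complex_def
    by (rule comm_group_restrict) (use cochain_complexD[OF F] subcomplexD[OF C] in auto)
  moreover have "d k \<in> hom (restrict_complex F C k) (restrict_complex F C (Suc k))" for k
    using cochain_complexD(2)[OF F, of k] subcomplexD[OF C] by (auto simp: hom_def)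
  ultimately show ?thesis
    using cochain_complexD(3)[OF F] subcomplexD[OF C] by (auto simp: cochain_complex_def)
qed

lemma cochain_map_restrict:
  assumes f: "cochain_map F d G e f" and C: "\<And>k. C k \<subseteq> carrier (F k)"
    and fC: "\<And>k. f k ` C k \<subseteq> D k"
  shows "cochain_map (restrict_complex F C) d (restrict_complex G D) e f"
  unfolding cochain_map_def
proof (intro conjI allI ballI)
  fix k
  have "f k \<in> hom (F k) (G k)" using f by (simp add: cochain_map_def)
  then have "f k (x \<otimes>\<^bsub>F k\<^esub> y) = f k x \<otimes>\<^bsub>G k\<^esub> f k y" if "x \<in> C k" "y \<in> C k" for x y
    using that C[of k] by (intro hom_mult) auto
  then show "f k \<in> hom (restrict_complex F C k) (restrict_complex G D k)"
    using fC[of k] by (auto simp: image_subset_iff intro!: homI)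
  show "f (Suc k) (d k x) = e k (f k x)" if "x \<in> carrier (restrict_complex F C k)" for x
    using f that subsetD[OF C, of x k] by (simp add: cochain_map_def)
qed

lemma coboundaries_restrict_subset:
  assumes "subcomplex F d C"
  shows "coboundaries (restrict_complex F C) d k \<subseteq> coboundaries F d k"
  using subcomplexD(3)[OF assms] by (auto simp: coboundaries_def split: nat.split)

text \<open>
  An isomorphism of complexes from \<open>F\<close> onto \<open>G\<close>, followed by a quasi-isomorphism that is the
  identity on elements, is a quasi-isomorphism.
\<close>

lemma quasi_iso_precompose_iso:
  assumes F: "cochain_complex F d" and G: "cochain_complex G e" and f: "cochain_map F d G e f"
    and inj: "\<And>k. inj_on (f k) (carrier (F k))" and onto: "\<And>k. f k ` carrier (F k) = carrier (G k)"
    and q: "quasi_iso G e H c (\<lambda>_. id)"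
  shows "quasi_iso F d H c f"
  unfolding quasi_iso_def
proof (intro allI conjI ballI impI)
  note f1 = cochain_map_one[OF F G f]
  have one: "\<one>\<^bsub>F k\<^esub> \<in> carrier (F k)" for k
    using cochain_complexD(1)[OF F, of k] by (simp add: comm_group_def group.is_monoid)
  have dF: "d k x \<in> carrier (F (Suc k))" if "x \<in> carrier (F k)" for k x
    using cochain_complexD(2)[OF F, of k] that by (auto simp: hom_def)
  have comm: "f (Suc k) (d k x) = e k (f k x)" if "x \<in> carrier (F k)" for k x
    using f that by (auto simp: cochain_map_def)
  fix k
  {
    fix x assume x: "x \<in> cocycles F d k" "f k x \<in> coboundaries H c k"
    then have xF: "x \<in> carrier (F k)" by (simp add: cocycles_def kernel_def)
    have "f k x \<in> cocycles G e k" by (rule cochain_map_cocycles[OF F G f x(1)])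
    then have b: "f k x \<in> coboundaries G e k" using quasi_isoD_inj[OF q] x(2) by simp
    show "x \<in> coboundaries F d k"
    proof (cases k)
      case 0
      then have "f 0 x = f 0 \<one>\<^bsub>F 0\<^esub>" using b by (simp add: coboundaries_def f1)
      then show ?thesis using inj_onD[OF inj _ _ one] xF 0 by (auto simp: coboundaries_def)
    next
      case (Suc n)
      then have "f k x \<in> e n ` f n ` carrier (F n)"
        using b onto[of n] by (simp add: coboundaries_def)
      then obtain w where "w \<in> carrier (F n)" "f k x = e n (f n w)" by blast
      then have "f k x = f k (d n w)" and w: "w \<in> carrier (F n)" using comm Suc by auto
      then have "x = d n w" using inj_onD[OF inj _ xF] dF Suc by auto
      then show ?thesis using Suc w by (simp add: coboundaries_def)
    qed
  next
    fix y assume "y \<in> cocycles H c k"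
    then obtain x z where x: "x \<in> cocycles G e k" "z \<in> coboundaries H c k" "y = z \<otimes>\<^bsub>H k\<^esub> x"
      using quasi_isoD_surj[OF q] by (metis id_apply)
    then obtain w where w: "w \<in> carrier (F k)" "x = f k w"
      using onto[of k] by (auto simp: cocycles_def kernel_def)
    have "f (Suc k) (d k w) = f (Suc k) \<one>\<^bsub>F (Suc k)\<^esub>"
      using x w comm by (simp add: f1 cocycles_def kernel_def)
    then have "d k w = \<one>\<^bsub>F (Suc k)\<^esub>" using inj_onD[OF inj _ dF one] w by blast
    then have "w \<in> cocycles F d k" using w by (simp add: cocycles_def kernel_def)
    then show "\<exists>x\<in>cocycles F d k. \<exists>z\<in>coboundaries H c k. y = z \<otimes>\<^bsub>H k\<^esub> f k x"
      using x w by blast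
  }
qed

text \<open>
  One case of the two-out-of-three property, for a subcomplex \<open>F\<close> of \<open>G\<close>.
\<close>

lemma quasi_iso_cancel:
  assumes F: "cochain_complex F d" and G: "cochain_complex G e" and H: "cochain_complex H c"
    and i: "cochain_map F d G e (\<lambda>_. id)" and f: "cochain_map G e H c f"
    and qi: "quasi_iso F d G e (\<lambda>_. id)" and qf: "quasi_iso F d H c f"
  shows "quasi_iso G e H c f"
  unfolding quasi_iso_def
proof (intro allI conjI ballI impI)
  fix k
  interpret Hk: comm_group "H k" by (rule cochain_complexD(1)[OF H])
  interpret BG: subgroup "coboundaries G e k" "G k" by (rule subgroup_coboundaries[OF G])
  interpret BH: subgroup "coboundaries H c k" "H k" by (rule subgroup_coboundaries[OF H])
  {
    fix x assume x: "x \<in> cocycles G e k" "f k x \<in> coboundaries H c k"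
    obtain w z where w: "w \<in> cocycles F d k" "z \<in> coboundaries G e k" "x = z \<otimes>\<^bsub>G k\<^esub> w"
      using quasi_isoD_surj[OF qi x(1)] by (metis id_apply)
    have wG: "w \<in> carrier (G k)"
      using cochain_map_cocycles[OF F G i w(1)] by (simp add: cocycles_def kernel_def)
    have "f k \<in> hom (G k) (H k)" using f by (simp add: cochain_map_def)
    then have eq: "f k x = f k z \<otimes>\<^bsub>H k\<^esub> f k w" "f k w \<in> carrier (H k)"
      using w wG BG.mem_carrier by (auto simp: hom_mult hom_in_carrier)
    have fz: "f k z \<in> coboundaries H c k" by (rule cochain_map_coboundaries[OF G H f w(2)])
    have "f k w = inv\<^bsub>H k\<^esub> f k z \<otimes>\<^bsub>H k\<^esub> f k x"
      using eq fz by (simp add: Hk.inv_solve_left)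
    then have "f k w \<in> coboundaries H c k" using fz x(2) by simp
    then have "w \<in> coboundaries F d k" using quasi_isoD_inj[OF qf w(1)] by simp
    then have "w \<in> coboundaries G e k" using cochain_map_coboundaries[OF F G i] by simp
    then show "x \<in> coboundaries G e k" using w by simp
  next
    fix y assume "y \<in> cocycles H c k"
    then obtain x z where x: "x \<in> cocycles F d k"
      and "z \<in> coboundaries H c k" "y = z \<otimes>\<^bsub>H k\<^esub> f k x"
      by (rule quasi_isoD_surj[OF qf])
    moreover have "x \<in> cocycles G e k" using cochain_map_cocycles[OF F G i x] by simp
    ultimately show "\<exists>x\<in>cocycles G e k. \<exists>z\<in>coboundaries H c k. y = z \<otimes>\<^bsub>H k\<^esub> f k x"
      by blast
  }
qed


section \<open>Spark complexes\<close>

lemma spark_complexD: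
  assumes "spark_complex S"
  shows "cochain_complex (cxF S) (cxd S)"
    "subcomplex (cxF S) (cxd S) (cxE S)" "subcomplex (cxF S) (cxd S) (cxI S)"
    "cochain_complex (complexE S) (cxd S)" "cochain_complex (complexI S) (cxd S)"
    "cochain_map (complexE S) (cxd S) (cxF S) (cxd S) (\<lambda>_. id)"
    "quasi_iso (complexE S) (cxd S) (cxF S) (cxd S) (\<lambda>_. id)"
    "k \<ge> 1 \<Longrightarrow> x \<in> cxE S k \<Longrightarrow> x \<in> cxI S k \<Longrightarrow> x = \<one>\<^bsub>cxF S k\<^esub>"
proof -
  show F: "cochain_complex (cxF S) (cxd S)"
    and E: "subcomplex (cxF S) (cxd S) (cxE S)" and I: "subcomplex (cxF S) (cxd S) (cxI S)"
    and "k \<ge> 1 \<Longrightarrow> x \<in> cxE S k \<Longrightarrow> x \<in> cxI S k \<Longrightarrow> x = \<one>\<^bsub>cxF S k\<^esub>"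
    using assms by (auto simp: spark_complex_def)
  show cE: "cochain_complex (complexE S) (cxd S)" and "cochain_complex (complexI S) (cxd S)"
    by (rule cochain_complex_restrict; fact F E I)+
  show m: "cochain_map (complexE S) (cxd S) (cxF S) (cxd S) (\<lambda>_. id)"
    using subcomplexD(3)[OF E] by (auto simp: cochain_map_def hom_def)
  show "quasi_iso (complexE S) (cxd S) (cxF S) (cxd S) (\<lambda>_. id)"
    using assms cohomology_map_iso_iff[OF cE F m] by (auto simp: spark_complex_def)
qed

text \<open>
  Since \<open>I\<close> is closed under inverses, the sign of \<open>r\<close> in \<open>da = \<phi> - r\<close> is immaterial.
\<close>

lemma sparks_eq:
  assumes "spark_complex S"
  shows "sparks S k =
    {a \<in> carrier (cxF S k). cxd S k a \<in> cxE S (Suc k) <#>\<^bsub>cxF S (Suc k)\<^esub> cxI S (Suc k)}"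
proof -
  interpret comm_group "cxF S (Suc k)" by (rule cochain_complexD(1)[OF spark_complexD(1)[OF assms]])
  interpret I: subgroup "cxI S (Suc k)" "cxF S (Suc k)"
    by (rule subcomplexD[OF spark_complexD(3)[OF assms]])
  have "(\<exists>r\<in>cxI S (Suc k). y = p \<otimes>\<^bsub>cxF S (Suc k)\<^esub> inv\<^bsub>cxF S (Suc k)\<^esub> r) \<longleftrightarrow>
      (\<exists>r\<in>cxI S (Suc k). y = p \<otimes>\<^bsub>cxF S (Suc k)\<^esub> r)" for y p
  proof
    assume "\<exists>r\<in>cxI S (Suc k). y = p \<otimes>\<^bsub>cxF S (Suc k)\<^esub> inv\<^bsub>cxF S (Suc k)\<^esub> r"
    then show "\<exists>r\<in>cxI S (Suc k). y = p \<otimes>\<^bsub>cxF S (Suc k)\<^esub> r" by blast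
  next
    assume "\<exists>r\<in>cxI S (Suc k). y = p \<otimes>\<^bsub>cxF S (Suc k)\<^esub> r"
    then obtain r where "r \<in> cxI S (Suc k)" "y = p \<otimes>\<^bsub>cxF S (Suc k)\<^esub> r" by blast
    then show "\<exists>r\<in>cxI S (Suc k). y = p \<otimes>\<^bsub>cxF S (Suc k)\<^esub> inv\<^bsub>cxF S (Suc k)\<^esub> r"
      by (intro bexI[of _ "inv\<^bsub>cxF S (Suc k)\<^esub> r"]) simp_all
  qed
  then show ?thesis by (simp add: sparks_def set_mult_def)
qed

lemma trivial_sparks_eq:
  "trivial_sparks S k = coboundaries (cxF S) (cxd S) k <#>\<^bsub>cxF S k\<^esub> cxI S k"
  unfolding trivial_sparks_def set_mult_def by blast

lemma subgroup_sparks: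
  assumes S: "spark_complex S" shows "subgroup (sparks S k) (cxF S k)"
proof -
  interpret F: group_hom "cxF S k" "cxF S (Suc k)" "cxd S k"
    by (rule cochain_complex_group_hom[OF spark_complexD(1)[OF S]])
  interpret EI: subgroup "cxE S (Suc k) <#>\<^bsub>cxF S (Suc k)\<^esub> cxI S (Suc k)" "cxF S (Suc k)"
    by (rule comm_group.mult_subgroups[OF cochain_complexD(1)[OF spark_complexD(1)[OF S]]
        subcomplexD(1)[OF spark_complexD(2)[OF S]] subcomplexD(1)[OF spark_complexD(3)[OF S]]])
  show ?thesis
    unfolding sparks_eq[OF S]
  proof (rule subgroup.intro, goal_cases)
    case (2 x y)
    then show ?case using EI.m_closed[of "cxd S k x" "cxd S k y"] by simp
  next
    case 3
    show ?case using EI.one_closed F.hom_one F.G.one_closed by simp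
  next
    case (4 x)
    then show ?case using EI.m_inv_closed[of "cxd S k x"] F.hom_inv[of x] by simp
  qed blast
qed

lemma subgroup_trivial_sparks:
  assumes S: "spark_complex S" shows "subgroup (trivial_sparks S k) (cxF S k)"
  unfolding trivial_sparks_eq
  by (rule comm_group.mult_subgroups[OF cochain_complexD(1)[OF spark_complexD(1)[OF S]]
      subgroup_coboundaries[OF spark_complexD(1)[OF S]] subcomplexD(1)[OF spark_complexD(3)[OF S]]])

lemma trivial_sparks_subset_sparks:
  assumes S: "spark_complex S" shows "trivial_sparks S k \<subseteq> sparks S k"
proof
  interpret F: group_hom "cxF S k" "cxF S (Suc k)" "cxd S k"
    by (rule cochain_complex_group_hom[OF spark_complexD(1)[OF S]])
  interpret E: subgroup "cxE S (Suc k)" "cxF S (Suc k)"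
    by (rule subcomplexD[OF spark_complexD(2)[OF S]])
  fix a assume "a \<in> trivial_sparks S k"
  then obtain b s where b: "b \<in> coboundaries (cxF S) (cxd S) k" and s: "s \<in> cxI S k"
    and a: "a = b \<otimes>\<^bsub>cxF S k\<^esub> s" by (auto simp: trivial_sparks_def)
  have "b \<in> cocycles (cxF S) (cxd S) k"
    using b coboundaries_subset_cocycles[OF spark_complexD(1)[OF S]] by blast
  then have "a \<in> carrier (cxF S k)" "cxd S k a = \<one>\<^bsub>cxF S (Suc k)\<^esub> \<otimes>\<^bsub>cxF S (Suc k)\<^esub> cxd S k s"
    using subcomplexD(3)[OF spark_complexD(3)[OF S] s] by (auto simp: a cocycles_def kernel_def)
  then show "a \<in> sparks S k"
    using E.one_closed subcomplexD(2)[OF spark_complexD(3)[OF S] s]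
    unfolding sparks_eq[OF S] set_mult_def by blast
qed


section \<open>Subspark embeddings\<close>

text \<open>
  The subspark condition speaks of the image of \<open>S\<close> in \<open>U\<close>; here it is transported back along the
  isomorphism of \<open>S\<close> with its image. The first quasi-isomorphism is a consequence of the equality of
  the \<open>E\<close>-parts, both of which compute the cohomology of the ambient complex.
\<close>

lemma subspark_embeddingD:
  assumes emb: "subspark_embedding S U f"
  shows "spark_complex S" "spark_complex U"
    "cochain_map (cxF S) (cxd S) (cxF U) (cxd U) f"
    "inj_on (f k) (carrier (cxF S k))"
    "f k ` cxE S k = cxE U k" "f k ` cxI S k \<subseteq> cxI U k"
    "cochain_map (complexI S) (cxd S) (complexI U) (cxd U) f"
    "quasi_iso (cxF S) (cxd S) (cxF U) (cxd U) f"
    "quasi_iso (complexI S) (cxd S) (complexI U) (cxd U) f"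
proof -
  define S' where "S' = image_spark_cx f S U"
  have [simp]: "cxF S' = restrict_complex (cxF U) (\<lambda>k. f k ` carrier (cxF S k))" "cxd S' = cxd U"
    "cxE S' = (\<lambda>k. f k ` cxE S k)" "cxI S' = (\<lambda>k. f k ` cxI S k)"
    by (simp_all add: S'_def image_spark_cx_def)
  have sub: "subspark_complex S' U" using emb by (simp add: subspark_embedding_def S'_def)
  show S: "spark_complex S" and U: "spark_complex U"
    and f: "cochain_map (cxF S) (cxd S) (cxF U) (cxd U) f"
    using emb sub by (auto simp: subspark_embedding_def subspark_complex_def cochain_map_def mon_def)
  have S': "spark_complex S'" using sub by (simp add: subspark_complex_def)
  have inj: "inj_on (f k) (carrier (cxF S k))" for k
    using emb by (auto simp: subspark_embedding_def mon_def)
  then show "inj_on (f k) (carrier (cxF S k))" .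
  have E: "f k ` cxE S k = cxE U k" and I: "f k ` cxI S k \<subseteq> cxI U k" for k
    using sub by (auto simp: subspark_complex_def)
  show "f k ` cxE S k = cxE U k" "f k ` cxI S k \<subseteq> cxI U k" by (fact E I)+
  have subE: "cxE S k \<subseteq> carrier (cxF S k)" and subI: "cxI S k \<subseteq> carrier (cxF S k)" for k
    using subcomplexD(3)[OF spark_complexD(2)[OF S]] subcomplexD(3)[OF spark_complexD(3)[OF S]]
    by (simp_all add: subset_iff)
  show "cochain_map (complexI S) (cxd S) (complexI U) (cxd U) f"
    by (rule cochain_map_restrict[OF f subI I])
  have fE: "cochain_map (complexE S) (cxd S) (complexE U) (cxd U) f"
    by (rule cochain_map_restrict[OF f subE]) (simp add: E)
  have fI: "cochain_map (complexI S) (cxd S) (complexI S') (cxd U) f"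
    using cochain_map_restrict[OF f subI] by simp
  have "cochain_map (complexI S') (cxd U) (complexI U) (cxd U) (\<lambda>_. id)"
    using I by (auto simp: cochain_map_def image_subset_iff intro!: homI)
  then have qI: "quasi_iso (complexI S') (cxd U) (complexI U) (cxd U) (\<lambda>_. id)"
    using sub cohomology_map_iso_iff[of "complexI S'" "cxd U" "complexI U" "cxd U" "\<lambda>_. id"]
      spark_complexD(5)[OF S'] spark_complexD(5)[OF U]
    by (simp add: subspark_complex_def)
  show "quasi_iso (complexI S) (cxd S) (complexI U) (cxd U) f"
    by (rule quasi_iso_precompose_iso[OF spark_complexD(5)[OF S] _ fI _ _ qI])
      (use spark_complexD(5)[OF S'] inj_on_subset[OF inj subI] in auto)
  have "quasi_iso (complexE S) (cxd S) (cxF U) (cxd U) f"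
    by (rule quasi_iso_precompose_iso[OF spark_complexD(4)[OF S] spark_complexD(4)[OF U] fE _ _
          spark_complexD(7)[OF U]])
      (use inj_on_subset[OF inj subE] E in auto)
  then show "quasi_iso (cxF S) (cxd S) (cxF U) (cxd U) f"
    by (rule quasi_iso_cancel[OF spark_complexD(4)[OF S] spark_complexD(1)[OF S]
          spark_complexD(1)[OF U] spark_complexD(6)[OF S] f spark_complexD(7)[OF S]])
qed

text \<open>
  From \<open>dda = 0\<close> it follows that \<open>dr\<close> lies in both \<open>E\<close> and \<open>I\<close>, in positive degree.
\<close>

lemma spark_differential_closed:
  assumes U: "spark_complex U" and a: "a \<in> carrier (cxF U k)"
    and p: "p \<in> cxE U (Suc k)" and r: "r \<in> cxI U (Suc k)"
    and da: "cxd U k a = p \<otimes>\<^bsub>cxF U (Suc k)\<^esub> r"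
  shows "r \<in> cocycles (complexI U) (cxd U) (Suc k)"
proof -
  let ?k = "Suc (Suc k)"
  interpret F: group_hom "cxF U (Suc k)" "cxF U ?k" "cxd U (Suc k)"
    by (rule cochain_complex_group_hom[OF spark_complexD(1)[OF U]])
  interpret E: subgroup "cxE U ?k" "cxF U ?k" by (rule subcomplexD[OF spark_complexD(2)[OF U]])
  have pF: "p \<in> carrier (cxF U (Suc k))" and rF: "r \<in> carrier (cxF U (Suc k))"
    using subcomplexD(3)[OF spark_complexD(2)[OF U] p] subcomplexD(3)[OF spark_complexD(3)[OF U] r] .
  have "cxd U (Suc k) p \<otimes>\<^bsub>cxF U ?k\<^esub> cxd U (Suc k) r = \<one>\<^bsub>cxF U ?k\<^esub>"
    using cochain_complexD(3)[OF spark_complexD(1)[OF U] a] pF rF by (simp add: da)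
  then have "cxd U (Suc k) r = inv\<^bsub>cxF U ?k\<^esub> cxd U (Suc k) p"
    using F.H.inv_solve_left[of "cxd U (Suc k) r" "cxd U (Suc k) p" "\<one>\<^bsub>cxF U ?k\<^esub>"] pF rF by simp
  then have "cxd U (Suc k) r \<in> cxE U ?k"
    using subcomplexD(2)[OF spark_complexD(2)[OF U] p] by simp
  then have "cxd U (Suc k) r = \<one>\<^bsub>cxF U ?k\<^esub>"
    using spark_complexD(8)[OF U] subcomplexD(2)[OF spark_complexD(3)[OF U] r] by simp
  then show ?thesis using r by (simp add: cocycles_def kernel_def)
qed

lemma subspark_embedding_sparks:
  assumes emb: "subspark_embedding S U f" and a: "a \<in> sparks S k"
  shows "f k a \<in> sparks U k"
proof -
  note D = subspark_embeddingD[OF emb]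
  obtain p r where a': "a \<in> carrier (cxF S k)" and p: "p \<in> cxE S (Suc k)" and r: "r \<in> cxI S (Suc k)"
    and da: "cxd S k a = p \<otimes>\<^bsub>cxF S (Suc k)\<^esub> r"
    using a unfolding sparks_eq[OF D(1)] set_mult_def by blast
  have pF: "p \<in> carrier (cxF S (Suc k))" and rF: "r \<in> carrier (cxF S (Suc k))"
    using subcomplexD(3)[OF spark_complexD(2)[OF D(1)] p]
      subcomplexD(3)[OF spark_complexD(3)[OF D(1)] r] .
  have hom: "f n \<in> hom (cxF S n) (cxF U n)" for n using D(3) by (simp add: cochain_map_def)
  have "cxd U k (f k a) = f (Suc k) (cxd S k a)" using D(3) a' by (simp add: cochain_map_def)
  also have "\<dots> = f (Suc k) p \<otimes>\<^bsub>cxF U (Suc k)\<^esub> f (Suc k) r"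
    by (simp add: da hom_mult[OF hom pF rF])
  finally show ?thesis
    using p r D(5,6)[of "Suc k"] hom_in_carrier[OF hom a']
    unfolding sparks_eq[OF D(2)] set_mult_def by blast
qed

lemma subspark_embedding_trivial_sparks:
  assumes emb: "subspark_embedding S U f" and a: "a \<in> trivial_sparks S k"
  shows "f k a \<in> trivial_sparks U k"
proof -
  note D = subspark_embeddingD[OF emb]
  obtain b s where b: "b \<in> coboundaries (cxF S) (cxd S) k" and s: "s \<in> cxI S k"
    and a: "a = b \<otimes>\<^bsub>cxF S k\<^esub> s" using a by (auto simp: trivial_sparks_def)
  have "f k \<in> hom (cxF S k) (cxF U k)" using D(3) by (simp add: cochain_map_def)
  then have "f k a = f k b \<otimes>\<^bsub>cxF U k\<^esub> f k s"
    unfolding a using subgroup.mem_carrier[OF subgroup_coboundaries[OF spark_complexD(1)[OF D(1)]] b]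
      subcomplexD(3)[OF spark_complexD(3)[OF D(1)] s] by (rule hom_mult)
  moreover have "f k b \<in> coboundaries (cxF U) (cxd U) k"
    by (rule cochain_map_coboundaries[OF spark_complexD(1)[OF D(1)] spark_complexD(1)[OF D(2)] D(3) b])
  ultimately show ?thesis using s D(6)[of k] by (auto simp: trivial_sparks_def)
qed

text \<open>Injectivity on spark classes.\<close>

lemma subspark_embedding_trivial_sparksD:
  assumes emb: "subspark_embedding S U f" and a: "a \<in> sparks S k"
    and fa: "f k a \<in> trivial_sparks U k"
  shows "a \<in> trivial_sparks S k"
proof -
  note D = subspark_embeddingD[OF emb]
  note S = spark_complexD[OF D(1)] and U = spark_complexD[OF D(2)]
  interpret S0: comm_group "cxF S k" by (rule cochain_complexD(1)[OF S(1)])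
  interpret S1: comm_group "cxF S (Suc k)" by (rule cochain_complexD(1)[OF S(1)])
  interpret U0: comm_group "cxF U k" by (rule cochain_complexD(1)[OF U(1)])
  interpret dS: group_hom "cxF S k" "cxF S (Suc k)" "cxd S k"
    by (rule cochain_complex_group_hom[OF S(1)])
  interpret dU: group_hom "cxF U k" "cxF U (Suc k)" "cxd U k"
    by (rule cochain_complex_group_hom[OF U(1)])
  interpret f0: group_hom "cxF S k" "cxF U k" "f k"
    using D(3) by unfold_locales (simp add: cochain_map_def)
  interpret f1: group_hom "cxF S (Suc k)" "cxF U (Suc k)" "f (Suc k)"
    using D(3) by unfold_locales (simp add: cochain_map_def)
  interpret BU: subgroup "coboundaries (cxF U) (cxd U) k" "cxF U k"
    by (rule subgroup_coboundaries[OF U(1)])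
  interpret IS: subgroup "cxI S k" "cxF S k" by (rule subcomplexD(1)[OF S(3)])
  interpret IU1: subgroup "cxI U (Suc k)" "cxF U (Suc k)" by (rule subcomplexD(1)[OF U(3)])
  have comm: "f (Suc k) (cxd S k x) = cxd U k (f k x)" if "x \<in> carrier (cxF S k)" for x
    using D(3) that by (simp add: cochain_map_def)
  obtain p r where aS: "a \<in> carrier (cxF S k)" and p: "p \<in> cxE S (Suc k)" and r: "r \<in> cxI S (Suc k)"
    and da: "cxd S k a = p \<otimes>\<^bsub>cxF S (Suc k)\<^esub> r"
    using a unfolding sparks_eq[OF D(1)] set_mult_def by blast
  have pS: "p \<in> carrier (cxF S (Suc k))" and rS: "r \<in> carrier (cxF S (Suc k))"
    using subcomplexD(3)[OF S(2) p] subcomplexD(3)[OF S(3) r] .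
  obtain b s where b: "b \<in> coboundaries (cxF U) (cxd U) k" and s: "s \<in> cxI U k"
    and fa: "f k a = b \<otimes>\<^bsub>cxF U k\<^esub> s" using fa by (auto simp: trivial_sparks_def)
  have sU: "s \<in> carrier (cxF U k)" by (rule subcomplexD(3)[OF U(3) s])
  have dcob: "cxd U k z = \<one>\<^bsub>cxF U (Suc k)\<^esub>" if "z \<in> coboundaries (cxF U) (cxd U) k" for z
    using coboundaries_subset_cocycles[OF U(1)] that by (auto simp: cocycles_def kernel_def)
  have ds: "cxd U k s = f (Suc k) p \<otimes>\<^bsub>cxF U (Suc k)\<^esub> f (Suc k) r"
  proof -
    have "cxd U k s = cxd U k (f k a)" using b sU by (simp add: fa dcob)
    also have "\<dots> = f (Suc k) (cxd S k a)" using comm[OF aS] by simp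
    also have "\<dots> = f (Suc k) p \<otimes>\<^bsub>cxF U (Suc k)\<^esub> f (Suc k) r" using pS rS by (simp add: da)
    finally show ?thesis .
  qed
  have fr: "f (Suc k) r \<in> cxI U (Suc k)" using r D(6) by blast
  have fp: "f (Suc k) p \<in> cxE U (Suc k)" using p D(5) by blast
  \<comment> \<open>\<open>\<phi> = ds - r\<close> lies in \<open>E \<inter> I\<close> in degree \<open>k + 1 \<ge> 1\<close>, hence vanishes\<close>
  have "f (Suc k) p = cxd U k s \<otimes>\<^bsub>cxF U (Suc k)\<^esub> inv\<^bsub>cxF U (Suc k)\<^esub> f (Suc k) r"
    using ds pS rS sU by (simp add: dU.H.inv_solve_right)
  then have "f (Suc k) p \<in> cxI U (Suc k)" using fr subcomplexD(2)[OF U(3) s] by simp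
  then have fp1: "f (Suc k) p = \<one>\<^bsub>cxF U (Suc k)\<^esub>" using U(8)[OF _ fp] by simp
  then have dsr: "cxd U k s = f (Suc k) r" using ds rS by simp
  have "f (Suc k) p = f (Suc k) \<one>\<^bsub>cxF S (Suc k)\<^esub>" using fp1 by simp
  then have "p = \<one>\<^bsub>cxF S (Suc k)\<^esub>" by (rule inj_onD[OF D(4) _ pS S1.one_closed])
  then have dar: "cxd S k a = r" using da rS by simp
  have "cxd S (Suc k) r = \<one>\<^bsub>cxF S (Suc (Suc k))\<^esub>"
    using cochain_complexD(3)[OF S(1) aS] dar by simp
  then have "r \<in> cocycles (complexI S) (cxd S) (Suc k)"
    using r by (simp add: cocycles_def kernel_def)
  moreover have "f (Suc k) r \<in> coboundaries (complexI U) (cxd U) (Suc k)"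
    using s by (simp flip: dsr add: coboundaries_def)
  ultimately have "r \<in> coboundaries (complexI S) (cxd S) (Suc k)"
    by (rule quasi_isoD_inj[OF D(9)])
  then obtain s' where s': "s' \<in> cxI S k" "r = cxd S k s'" by (auto simp: coboundaries_def)
  have fs': "f k s' \<in> cxI U k" using s' D(6) by blast
  interpret IU: subgroup "cxI U k" "cxF U k" by (rule subcomplexD(1)[OF U(3)])
  \<comment> \<open>correct \<open>s'\<close> by a cocycle \<open>t\<close> of \<open>I\<^sub>S\<close> so that \<open>s\<close> and \<open>t + s'\<close> differ by a coboundary\<close>
  have "cxd U k (s \<otimes>\<^bsub>cxF U k\<^esub> inv\<^bsub>cxF U k\<^esub> f k s') = \<one>\<^bsub>cxF U (Suc k)\<^esub>"
    using comm[of s'] s' s fs' dsr rS by simp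
  then have "s \<otimes>\<^bsub>cxF U k\<^esub> inv\<^bsub>cxF U k\<^esub> f k s' \<in> cocycles (complexI U) (cxd U) k"
    using s fs' by (simp add: cocycles_def kernel_def)
  then obtain t z where t: "t \<in> cocycles (complexI S) (cxd S) k"
    and z: "z \<in> coboundaries (complexI U) (cxd U) k"
    and tz: "s \<otimes>\<^bsub>cxF U k\<^esub> inv\<^bsub>cxF U k\<^esub> f k s' = z \<otimes>\<^bsub>cxF U k\<^esub> f k t"
    by (rule quasi_isoD_surj[OF D(9), unfolded restrict_complex_simps])
  have zB: "z \<in> coboundaries (cxF U) (cxd U) k" using z coboundaries_restrict_subset[OF U(3)] by blast
  have tI: "t \<in> cxI S k" using t by (simp add: cocycles_def kernel_def)
  have "s = z \<otimes>\<^bsub>cxF U k\<^esub> f k t \<otimes>\<^bsub>cxF U k\<^esub> f k s'"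
    using tz sU fs' zB tI by (simp flip: tz add: U0.m_assoc)
  then have fa': "f k a = (b \<otimes>\<^bsub>cxF U k\<^esub> z) \<otimes>\<^bsub>cxF U k\<^esub> f k (t \<otimes>\<^bsub>cxF S k\<^esub> s')"
    using b zB tI s' by (simp add: fa U0.m_assoc)
  define x where "x = a \<otimes>\<^bsub>cxF S k\<^esub> inv\<^bsub>cxF S k\<^esub> (t \<otimes>\<^bsub>cxF S k\<^esub> s')"
  have xS: "x \<in> carrier (cxF S k)" using aS tI s' by (simp add: x_def)
  have tsS: "t \<otimes>\<^bsub>cxF S k\<^esub> s' \<in> carrier (cxF S k)" using tI s' by simp
  have "f k x = f k a \<otimes>\<^bsub>cxF U k\<^esub> inv\<^bsub>cxF U k\<^esub> f k (t \<otimes>\<^bsub>cxF S k\<^esub> s')"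
    unfolding x_def f0.hom_mult[OF aS S0.inv_closed[OF tsS]] f0.hom_inv[OF tsS] ..
  also have "\<dots> = b \<otimes>\<^bsub>cxF U k\<^esub> z"
    unfolding fa' using f0.hom_closed[OF tsS] b zB by (simp add: U0.m_assoc del: f0.hom_mult)
  finally have "f k x = b \<otimes>\<^bsub>cxF U k\<^esub> z" .
  then have fx: "f k x \<in> coboundaries (cxF U) (cxd U) k" using b zB by simp
  then have "f (Suc k) (cxd S k x) = f (Suc k) \<one>\<^bsub>cxF S (Suc k)\<^esub>"
    using comm[OF xS] dcob by simp
  then have "cxd S k x = \<one>\<^bsub>cxF S (Suc k)\<^esub>"
    by (rule inj_onD[OF D(4) _ dS.hom_closed[OF xS] S1.one_closed])
  then have "x \<in> cocycles (cxF S) (cxd S) k" using xS by (simp add: cocycles_def kernel_def)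
  then have "x \<in> coboundaries (cxF S) (cxd S) k" by (rule quasi_isoD_inj[OF D(8) _ fx])
  moreover have "a = x \<otimes>\<^bsub>cxF S k\<^esub> (t \<otimes>\<^bsub>cxF S k\<^esub> s')"
    using aS tI s' by (simp add: x_def S0.m_assoc S0.l_inv)
  ultimately show ?thesis using tI s' by (auto simp: trivial_sparks_def)
qed

text \<open>Surjectivity on spark classes.\<close>

lemma subspark_embedding_sparks_onto:
  assumes emb: "subspark_embedding S U f" and a: "a \<in> sparks U k"
  obtains a' n where "a' \<in> sparks S k" "n \<in> trivial_sparks U k" "a = n \<otimes>\<^bsub>cxF U k\<^esub> f k a'"
proof -
  note D = subspark_embeddingD[OF emb]
  note S = spark_complexD[OF D(1)] and U = spark_complexD[OF D(2)]
  interpret S0: comm_group "cxF S k" by (rule cochain_complexD(1)[OF S(1)])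
  interpret S1: comm_group "cxF S (Suc k)" by (rule cochain_complexD(1)[OF S(1)])
  interpret U0: comm_group "cxF U k" by (rule cochain_complexD(1)[OF U(1)])
  interpret U1: comm_group "cxF U (Suc k)" by (rule cochain_complexD(1)[OF U(1)])
  interpret dS: group_hom "cxF S k" "cxF S (Suc k)" "cxd S k"
    by (rule cochain_complex_group_hom[OF S(1)])
  interpret dU: group_hom "cxF U k" "cxF U (Suc k)" "cxd U k"
    by (rule cochain_complex_group_hom[OF U(1)])
  interpret f0: group_hom "cxF S k" "cxF U k" "f k"
    using D(3) by unfold_locales (simp add: cochain_map_def)
  interpret f1: group_hom "cxF S (Suc k)" "cxF U (Suc k)" "f (Suc k)"
    using D(3) by unfold_locales (simp add: cochain_map_def)
  interpret f2: group_hom "cxF S (Suc (Suc k))" "cxF U (Suc (Suc k))" "f (Suc (Suc k))"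
    using D(3) cochain_complexD(1)[OF S(1), of "Suc (Suc k)"] cochain_complexD(1)[OF U(1), of "Suc (Suc k)"]
    by (simp add: cochain_map_def group_hom_def group_hom_axioms_def comm_group_def)
  have comm: "f (Suc n) (cxd S n x) = cxd U n (f n x)" if "x \<in> carrier (cxF S n)" for x n
    using D(3) that by (simp add: cochain_map_def)
  obtain p r where aU: "a \<in> carrier (cxF U k)" and p: "p \<in> cxE U (Suc k)" and r: "r \<in> cxI U (Suc k)"
    and da: "cxd U k a = p \<otimes>\<^bsub>cxF U (Suc k)\<^esub> r"
    using a unfolding sparks_eq[OF D(2)] set_mult_def by blast
  obtain p' where p': "p' \<in> cxE S (Suc k)" "p = f (Suc k) p'" using p D(5)[of "Suc k"] by blast
  obtain r' z where r': "r' \<in> cocycles (complexI S) (cxd S) (Suc k)"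
    and "z \<in> coboundaries (complexI U) (cxd U) (Suc k)"
    and rz: "r = z \<otimes>\<^bsub>cxF U (Suc k)\<^esub> f (Suc k) r'"
    by (rule quasi_isoD_surj[OF D(9) spark_differential_closed[OF D(2) aU p r da],
          unfolded restrict_complex_simps])
  then obtain s where s: "s \<in> cxI U k" "z = cxd U k s" by (auto simp: coboundaries_def)
  have sU: "s \<in> carrier (cxF U k)" by (rule subcomplexD(3)[OF U(3) s(1)])
  have rI: "r' \<in> cxI S (Suc k)" using r' by (simp add: cocycles_def kernel_def)
  have pS: "p' \<in> carrier (cxF S (Suc k))" and rS: "r' \<in> carrier (cxF S (Suc k))"
    using subcomplexD(3)[OF S(2) p'(1)] subcomplexD(3)[OF S(3) rI] .
  \<comment> \<open>\<open>y\<close> is the differential of \<open>b = a - s\<close>, moved into \<open>F\<^sub>S\<close>\<close>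
  define y where "y = p' \<otimes>\<^bsub>cxF S (Suc k)\<^esub> r'"
  have yS: "y \<in> carrier (cxF S (Suc k))" using pS rS by (simp add: y_def)
  define b where "b = a \<otimes>\<^bsub>cxF U k\<^esub> inv\<^bsub>cxF U k\<^esub> s"
  have bU: "b \<in> carrier (cxF U k)" using aU sU by (simp add: b_def)
  have "cxd U k a = f (Suc k) y \<otimes>\<^bsub>cxF U (Suc k)\<^esub> cxd U k s"
    using pS rS sU by (simp add: da p' rz s y_def U1.m_ac)
  then have db: "cxd U k b = f (Suc k) y"
    using aU sU yS by (simp add: b_def U1.m_assoc)
  have "f (Suc (Suc k)) (cxd S (Suc k) y) = f (Suc (Suc k)) \<one>\<^bsub>cxF S (Suc (Suc k))\<^esub>"
    using comm[OF yS] cochain_complexD(3)[OF U(1) bU] by (simp add: db)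
  moreover have "cxd S (Suc k) y \<in> carrier (cxF S (Suc (Suc k)))"
    using cochain_complexD(2)[OF S(1)] yS by (rule hom_in_carrier)
  ultimately have "cxd S (Suc k) y = \<one>\<^bsub>cxF S (Suc (Suc k))\<^esub>"
    by (rule inj_onD[OF D(4) _ _ f2.G.one_closed])
  then have "y \<in> cocycles (cxF S) (cxd S) (Suc k)" using yS by (simp add: cocycles_def kernel_def)
  moreover have "f (Suc k) y \<in> coboundaries (cxF U) (cxd U) (Suc k)"
    using bU by (simp flip: db add: coboundaries_def)
  ultimately have "y \<in> coboundaries (cxF S) (cxd S) (Suc k)"
    by (rule quasi_isoD_inj[OF D(8)])
  then obtain v where v: "v \<in> carrier (cxF S k)" "y = cxd S k v" by (auto simp: coboundaries_def)
  \<comment> \<open>the cocycle \<open>b - v\<close> is cohomologous to a cocycle \<open>c\<close> of \<open>F\<^sub>S\<close>\<close>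
  have "cxd U k (b \<otimes>\<^bsub>cxF U k\<^esub> inv\<^bsub>cxF U k\<^esub> f k v) = \<one>\<^bsub>cxF U (Suc k)\<^esub>"
    using v bU by (simp add: db comm[symmetric])
  then have "b \<otimes>\<^bsub>cxF U k\<^esub> inv\<^bsub>cxF U k\<^esub> f k v \<in> cocycles (cxF U) (cxd U) k"
    using v bU by (simp add: cocycles_def kernel_def)
  then obtain c w where c: "c \<in> cocycles (cxF S) (cxd S) k" and w: "w \<in> coboundaries (cxF U) (cxd U) k"
    and cw: "b \<otimes>\<^bsub>cxF U k\<^esub> inv\<^bsub>cxF U k\<^esub> f k v = w \<otimes>\<^bsub>cxF U k\<^esub> f k c"
    by (rule quasi_isoD_surj[OF D(8)])
  have cS: "c \<in> carrier (cxF S k)" "cxd S k c = \<one>\<^bsub>cxF S (Suc k)\<^esub>"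
    using c by (simp_all add: cocycles_def kernel_def)
  have wU: "w \<in> carrier (cxF U k)" by (rule subgroup.mem_carrier[OF subgroup_coboundaries[OF U(1)] w])
  show ?thesis
  proof (rule that)
    have "cxd S k (c \<otimes>\<^bsub>cxF S k\<^esub> v) = p' \<otimes>\<^bsub>cxF S (Suc k)\<^esub> r'"
      using cS v yS by (simp add: y_def[symmetric])
    then show "c \<otimes>\<^bsub>cxF S k\<^esub> v \<in> sparks S k"
      using cS v p' rI unfolding sparks_eq[OF D(1)] set_mult_def by blast
    show "w \<otimes>\<^bsub>cxF U k\<^esub> s \<in> trivial_sparks U k" using w s by (auto simp: trivial_sparks_def)
    have "a = (b \<otimes>\<^bsub>cxF U k\<^esub> inv\<^bsub>cxF U k\<^esub> f k v) \<otimes>\<^bsub>cxF U k\<^esub> f k v \<otimes>\<^bsub>cxF U k\<^esub> s"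
      using aU sU v by (simp add: b_def U0.m_assoc)
    then show "a = (w \<otimes>\<^bsub>cxF U k\<^esub> s) \<otimes>\<^bsub>cxF U k\<^esub> f k (c \<otimes>\<^bsub>cxF S k\<^esub> v)"
      using wU sU cS v by (simp add: cw U0.m_ac)
  qed
qed

lemma spark_class_map_iso_nat:
  assumes emb: "subspark_embedding S U f"
  shows "quot_map (cxF U k) (trivial_sparks U k) (f k) \<in>
    iso ((cxF S k)\<lparr>carrier := sparks S k\<rparr> Mod trivial_sparks S k)
        ((cxF U k)\<lparr>carrier := sparks U k\<rparr> Mod trivial_sparks U k)"
proof -
  note D = subspark_embeddingD[OF emb]
  let ?S = "(cxF S k)\<lparr>carrier := sparks S k\<rparr>" and ?U = "(cxF U k)\<lparr>carrier := sparks U k\<rparr>"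
  interpret S: comm_group "cxF S k" by (rule cochain_complexD(1)[OF spark_complexD(1)[OF D(1)]])
  interpret U: comm_group "cxF U k" by (rule cochain_complexD(1)[OF spark_complexD(1)[OF D(2)]])
  have "f k \<in> hom (cxF S k) (cxF U k)" using D(3) by (simp add: cochain_map_def)
  then have hom: "f k \<in> hom ?S ?U"
    using subspark_embedding_sparks[OF emb] subgroup.mem_carrier[OF subgroup_sparks[OF D(1), of k]]
    by (simp add: hom_def)
  have "quot_map ?U (trivial_sparks U k) (f k) \<in>
      iso (?S Mod trivial_sparks S k) (?U Mod trivial_sparks U k)"
  proof (rule quot_map_iso_iff[THEN iffD2, OF _ _ hom])
    show "comm_group ?S"
      by (rule comm_group_restrict[OF S.comm_group_axioms subgroup_sparks[OF D(1)]])
    show "comm_group ?U"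
      by (rule comm_group_restrict[OF U.comm_group_axioms subgroup_sparks[OF D(2)]])
    show "subgroup (trivial_sparks S k) ?S"
      by (rule S.subgroup_incl[OF subgroup_trivial_sparks subgroup_sparks
            trivial_sparks_subset_sparks]) (rule D(1))+
    show "subgroup (trivial_sparks U k) ?U"
      by (rule U.subgroup_incl[OF subgroup_trivial_sparks subgroup_sparks
            trivial_sparks_subset_sparks]) (rule D(2))+
    show "f k ` trivial_sparks S k \<subseteq> trivial_sparks U k"
      using subspark_embedding_trivial_sparks[OF emb] by blast
    show "(\<forall>a\<in>carrier ?S. f k a \<in> trivial_sparks U k \<longrightarrow> a \<in> trivial_sparks S k) \<and>
      (\<forall>b\<in>carrier ?U. \<exists>a\<in>carrier ?S. \<exists>n\<in>trivial_sparks U k. b = n \<otimes>\<^bsub>?U\<^esub> f k a)"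
    proof (intro conjI ballI impI)
      fix a assume "a \<in> carrier ?S" "f k a \<in> trivial_sparks U k"
      then show "a \<in> trivial_sparks S k" using subspark_embedding_trivial_sparksD[OF emb] by simp
    next
      fix b assume "b \<in> carrier ?U"
      then have "b \<in> sparks U k" by simp
      then obtain a n where "a \<in> sparks S k" "n \<in> trivial_sparks U k" "b = n \<otimes>\<^bsub>cxF U k\<^esub> f k a"
        by (rule subspark_embedding_sparks_onto[OF emb])
      then show "\<exists>a\<in>carrier ?S. \<exists>n\<in>trivial_sparks U k. b = n \<otimes>\<^bsub>?U\<^esub> f k a" by auto
    qed
  qed
  then show ?thesis by simp
qed

lemma group_spark_class_group:
  assumes S: "spark_complex S" shows "group (spark_class_group S k)"
proof -
  have *: "group ((F\<lparr>carrier := H\<rparr>) Mod N)"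
    if "comm_group F" "subgroup H F" "subgroup N F" "N \<subseteq> H" for F :: "'a monoid" and H N
  proof -
    interpret F: comm_group F by fact
    interpret H: comm_group "F\<lparr>carrier := H\<rparr>" by (rule comm_group_restrict) fact+
    show ?thesis
      by (intro normal.factorgroup_is_group H.subgroup_imp_normal F.subgroup_incl that)
  qed
  show ?thesis
    unfolding spark_class_group_def cohomology_def
    using spark_complexD(1,5)[OF S]
    by (simp add: * cochain_complexD(1) subgroup_cocycles subgroup_coboundaries
        coboundaries_subset_cocycles subgroup_sparks[OF S] subgroup_trivial_sparks[OF S]
        trivial_sparks_subset_sparks[OF S])
qed

lemma spark_class_map_iso:
  assumes emb: "subspark_embedding S U f"
  shows "spark_class_map U f k \<in> iso (spark_class_group S k) (spark_class_group U k)"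
proof (cases "k = -1")
  case True
  note D = subspark_embeddingD[OF emb]
  have "cohomology_map (complexI U) (cxd U) f 0 \<in>
      iso (cohomology (complexI S) (cxd S) 0) (cohomology (complexI U) (cxd U) 0)"
    using cohomology_map_iso_iff[OF spark_complexD(5)[OF D(1)] spark_complexD(5)[OF D(2)] D(7)] D(9)
    by blast
  then show ?thesis using True by (simp add: spark_class_map_def spark_class_group_def)
next
  case False
  then show ?thesis
    using spark_class_map_iso_nat[OF emb] by (simp add: spark_class_map_def spark_class_group_def)
qed

theorem proposition1p4:
  fixes S :: "'a spark_cx" and T :: "'b spark_cx" and U :: "'c spark_cx"
    and i :: "nat \<Rightarrow> 'a \<Rightarrow> 'c" and j :: "nat \<Rightarrow> 'b \<Rightarrow> 'c" and k :: int
  assumes "spark_complex S" and "spark_complex T"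
    and "compatible_via U i j S T"
    and "k \<ge> -1"
  shows "spark_class_map U i k \<in> iso (spark_class_group S k) (spark_class_group U k) \<and>
    spark_class_map U j k \<in> iso (spark_class_group T k) (spark_class_group U k) \<and>
    (\<lambda>A. inv_into (carrier (spark_class_group T k)) (spark_class_map U j k)
           (spark_class_map U i k A))
      \<in> iso (spark_class_group S k) (spark_class_group T k)"
proof -
  have i: "spark_class_map U i k \<in> iso (spark_class_group S k) (spark_class_group U k)"
    and j: "spark_class_map U j k \<in> iso (spark_class_group T k) (spark_class_group U k)"
    using assms(3) by (auto simp: compatible_via_def intro: spark_class_map_iso)
  have "inv_into (carrier (spark_class_group T k)) (spark_class_map U j k)
      \<in> iso (spark_class_group U k) (spark_class_group T k)"
    by (rule group.iso_set_sym[OF group_spark_class_group[OF assms(2)] j])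
  from iso_set_trans[OF i this] i j show ?thesis by (simp add: comp_def)
qed

end
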